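(* Let $\mathcal{Z}\subseteq\mathbb{R}^p$ be a nonempty closed convex set equipped with a $\nu$-self-concordant barrier $F$, and let $\mathcal{A}:\mathbb{R}^p\rightrightarrows 2^{\mathbb{R}^p}$ be maximally monotone with $\mathrm{int}(\mathcal{Z})\cap\mathrm{dom}(\mathcal{A})\neq\emptyset$ and with $\mathrm{dom}(\mathcal{A})$ either open or closed, and suppose the solution set $\mathcal{Z}^\star=\{\mathbf{z}\mid 0\in\mathcal{A}(\mathbf{z})+\mathcal{N}_{\mathcal{Z}}(\mathbf{z})\}$ is nonempty. Suppose that for any nonzero $\boldsymbol{\omega}$ in the horizon cone of $\mathrm{int}(\mathcal{Z})\cap\mathrm{dom}(\mathcal{A})$ there exists some $\hat{\mathbf{z}}\in\mathrm{int}(\mathcal{Z})\cap\mathrm{dom}(\mathcal{A})$ with $\hat{\mathbf{a}}\in\mathcal{A}(\hat{\mathbf{z}})$ such that $\langle\hat{\mathbf{a}},\boldsymbol{\omega}\rangle>0$. Then, for each $t>0$, the problem of finding $\mathbf{z}^\star_t\in\mathrm{int}(\mathcal{Z})$ such that $$0\in t\nabla F(\mathbf{z}^\star_t)+\mathcal{A}(\mathbf{z}^\star_t)$$ has a unique solution $\mathbf{z}^\star_t$. Moreover, $\mathrm{dist}_{\mathbf{z}^\star_t}\big(\boldsymbol{0},\mathcal{A}(\mathbf{z}^\star_t)\big)\le t\sqrt{\nu}$, and consequently $\mathbf{z}^\star_t$ is an $\varepsilon$-solution of the inclusion $0\in\mathcal{A}(\mathbf{z})+\mathcal{N}_{\mathcal{Z}}(\mathbf{z})$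 if $t\le\varepsilon/\sqrt{\nu}$.
   Context: A convex univariate $\varphi\in\mathcal{C}^3$ on an open domain is standard self-concordant if $|\varphi'''(\tau)|\le 2\varphi''(\tau)^{3/2}$ on its domain; $F$ is standard self-concordant if $\tau\mapsto F(\mathbf{z}+\tau\mathbf{v})$ is so for all $\mathbf{z}\in\mathrm{dom}(F)$, $\mathbf{v}\in\mathbb{R}^p$. A standard self-concordant function $F$ is a $\nu$-self-concordant barrier ($\nu>0$) for $\mathcal{Z}$ if $\mathrm{dom}(F)=\mathrm{int}(\mathcal{Z})$, $\sup_{\mathbf{u}\in\mathbb{R}^p}\{2\langle\nabla F(\mathbf{z}),\mathbf{u}\rangle-\|\mathbf{u}\|_{\mathbf{z}}^2\}\le\nu$ for all $\mathbf{z}\in\mathrm{dom}(F)$, and $F(\mathbf{z})\to+\infty$ as $\mathbf{z}$ approaches the boundary of $\mathcal{Z}$. It is assumed that $\nabla^2F(\mathbf{z})$ is symmetric positive definite for $\mathbf{z}\in\mathrm{int}(\mathcal{Z})$. Local norms: $\|\mathbf{u}\|_{\mathbf{z}}=\langle\nabla^2F(\mathbf{z})\mathbf{u},\mathbf{u}\rangle^{1/2}$ and $\|\mathbf{v}\|^*_{\mathbf{z}}=\langle\nabla^2F(\mathbf{z})^{-1}\mathbf{v},\mathbf{v}\rangle^{1/2}$. $\mathcal{N}_{\mathcal{Z}}(\mathbf{z})=\{\mathbf{w}\mid\langle\mathbf{w},\mathbf{z}-\hat{\mathbf{z}}\rangle\ge0\ \forall\hat{\mathbf{z}}\in\mathcal{Z}\}$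 if $\mathbf{z}\in\mathcal{Z}$, and $\emptyset$ otherwise. $\mathrm{dom}(\mathcal{A})=\{\mathbf{z}\mid\mathcal{A}(\mathbf{z})\ne\emptyset\}$. The horizon cone of a convex set $C$ consists of the vectors $\boldsymbol\omega$ such that $\mathbf{z}+\tau\boldsymbol\omega\in\mathrm{cl}(C)$ for any $\mathbf{z}\in C$ and any $\tau>0$. $\mathrm{dist}_{\mathbf{z}}(\boldsymbol{0},\mathcal{A}(\mathbf{w}))=\min\{\|\mathbf{e}\|^*_{\mathbf{z}}\mid\mathbf{e}\in\mathcal{A}(\mathbf{w})\}$. For $\varepsilon\ge0$, a point $\tilde{\mathbf{z}}\in\mathrm{int}(\mathcal{Z})$ is an $\varepsilon$-solution of $0\in\mathcal{A}(\mathbf{z})+\mathcal{N}_{\mathcal{Z}}(\mathbf{z})$ if $\mathrm{dist}_{\tilde{\mathbf{z}}}(\boldsymbol{0},\mathcal{A}(\tilde{\mathbf{z}}))\le\varepsilon$. *)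

theory Defs
  imports "HOL-Analysis.Analysis"
begin

section \<open>Gradient, Hessian and local norms\<close>

definition grad :: "(real^'p \<Rightarrow> real) \<Rightarrow> real^'p \<Rightarrow> real^'p" where
  "grad F z = (THE g. GDERIV F z :> g)"

definition hessian :: "(real^'p \<Rightarrow> real) \<Rightarrow> real^'p \<Rightarrow> real^'p^'p" where
  "hessian F z = jacobian (grad F) (at z)"

text \<open>On an open set, this makes \<^term>\<open>grad\<close> and \<^term>\<open>hessian\<close>
  genuine first and second derivatives.\<close>

definition twice_differentiable_on :: "(real^'p \<Rightarrow> real) \<Rightarrow> (real^'p) set \<Rightarrow> bool" where
  "twice_differentiable_on F D \<longleftrightarrow>
     (\<forall>z\<in>D. F differentiable (at z) \<and> grad F differentiable (at z))"

definition sym_pos_def :: "real^'p^'p \<Rightarrow> bool" where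
  "sym_pos_def H \<longleftrightarrow> transpose H = H \<and> (\<forall>u. u \<noteq> 0 \<longrightarrow> (H *v u) \<bullet> u > 0)"

definition local_norm :: "(real^'p \<Rightarrow> real) \<Rightarrow> real^'p \<Rightarrow> real^'p \<Rightarrow> real" where
  "local_norm F z u = sqrt ((hessian F z *v u) \<bullet> u)"

definition dual_local_norm :: "(real^'p \<Rightarrow> real) \<Rightarrow> real^'p \<Rightarrow> real^'p \<Rightarrow> real" where
  "dual_local_norm F z v = sqrt ((matrix_inv (hessian F z) *v v) \<bullet> v)"


section \<open>Self-concordant barriers\<close>

text \<open>An extended-valued function is represented by a real-valued \<^term>\<open>F\<close> together
  with its domain \<^term>\<open>D\<close>; the values of \<^term>\<open>F\<close> off \<^term>\<open>D\<close> are
  never used.\<close>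

definition C3_on :: "(real \<Rightarrow> real) \<Rightarrow> real set \<Rightarrow> bool" where
  "C3_on \<phi> D \<longleftrightarrow>
     (\<forall>k<3. \<forall>\<tau>\<in>D. (deriv ^^ k) \<phi> field_differentiable (at \<tau>)) \<and>
     continuous_on D ((deriv ^^ 3) \<phi>)"

definition std_self_concordant1 :: "(real \<Rightarrow> real) \<Rightarrow> real set \<Rightarrow> bool" where
  "std_self_concordant1 \<phi> D \<longleftrightarrow>
     open D \<and> convex_on D \<phi> \<and> C3_on \<phi> D \<and>
     (\<forall>\<tau>\<in>D. \<bar>(deriv ^^ 3) \<phi> \<tau>\<bar> \<le> 2 * (deriv ^^ 2) \<phi> \<tau> powr (3/2))"

definition std_self_concordant :: "(real^'p \<Rightarrow> real) \<Rightarrow> (real^'p) set \<Rightarrow> bool" where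
  "std_self_concordant F D \<longleftrightarrow>
     (\<forall>z\<in>D. \<forall>v. std_self_concordant1 (\<lambda>\<tau>. F (z + \<tau> *\<^sub>R v)) {\<tau>. z + \<tau> *\<^sub>R v \<in> D})"

text \<open>The domain of the barrier is the interior of \<^term>\<open>Z\<close>. The supremum is taken in
  the extended reals, so that it always exists.\<close>

definition self_concordant_barrier ::
    "real \<Rightarrow> (real^'p \<Rightarrow> real) \<Rightarrow> (real^'p) set \<Rightarrow> bool" where
  "self_concordant_barrier \<nu> F Z \<longleftrightarrow>
     \<nu> > 0 \<and>
     std_self_concordant F (interior Z) \<and>
     (\<forall>z\<in>interior Z. (SUP u. ereal (2 * (grad F z \<bullet> u) - (local_norm F z u)\<^sup>2)) \<le> ereal \<nu>) \<and>
     (\<forall>b\<in>frontier Z. filterlim F at_top (at b within interior Z))"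


section \<open>Set-valued operators\<close>

definition op_dom :: "(real^'p \<Rightarrow> (real^'p) set) \<Rightarrow> (real^'p) set" where
  "op_dom A = {z. A z \<noteq> {}}"

definition monotone_op :: "(real^'p \<Rightarrow> (real^'p) set) \<Rightarrow> bool" where
  "monotone_op A \<longleftrightarrow> (\<forall>x y. \<forall>u\<in>A x. \<forall>v\<in>A y. (u - v) \<bullet> (x - y) \<ge> 0)"

definition maximally_monotone :: "(real^'p \<Rightarrow> (real^'p) set) \<Rightarrow> bool" where
  "maximally_monotone A \<longleftrightarrow>
     monotone_op A \<and> (\<forall>B. monotone_op B \<and> (\<forall>x. A x \<subseteq> B x) \<longrightarrow> B = A)"

definition normal_cone :: "(real^'p) set \<Rightarrow> real^'p \<Rightarrow> (real^'p) set" where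
  "normal_cone Z z = (if z \<in> Z then {w. \<forall>y\<in>Z. w \<bullet> (z - y) \<ge> 0} else {})"

definition horizon_cone :: "(real^'p) set \<Rightarrow> (real^'p) set" where
  "horizon_cone C = {\<omega>. \<forall>z\<in>C. \<forall>\<tau>>0. z + \<tau> *\<^sub>R \<omega> \<in> closure C}"

text \<open>\<^term>\<open>A z + normal_cone Z z\<close> is the Minkowski sum.\<close>

definition solution_set ::
    "(real^'p \<Rightarrow> (real^'p) set) \<Rightarrow> (real^'p) set \<Rightarrow> (real^'p) set" where
  "solution_set A Z = {z. 0 \<in> A z + normal_cone Z z}"

definition central_point ::
    "(real^'p \<Rightarrow> real) \<Rightarrow> (real^'p \<Rightarrow> (real^'p) set) \<Rightarrow> (real^'p) set \<Rightarrow>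
     real \<Rightarrow> real^'p \<Rightarrow> bool" where
  "central_point F A Z t z \<longleftrightarrow> z \<in> interior Z \<and> 0 \<in> {t *\<^sub>R grad F z} + A z"

text \<open>The distance from the origin to \<^term>\<open>S\<close> in the dual local norm at
  \<^term>\<open>z\<close>. It is an attained minimum, hence \<open>LEAST\<close> rather than an infimum: to bound
  it one has to show that the minimum exists. Inserting \<^term>\<open>\<infinity>::ereal\<close> only matters
  when \<^term>\<open>S\<close> is empty, in which case the distance is \<^term>\<open>\<infinity>::ereal\<close>.\<close>

definition dist_zero ::
    "(real^'p \<Rightarrow> real) \<Rightarrow> real^'p \<Rightarrow> (real^'p) set \<Rightarrow> ereal" where
  "dist_zero F z S = (LEAST d. d \<in> insert \<infinity> ((\<lambda>e. ereal (dual_local_norm F z e)) ` S))"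

definition eps_solution ::
    "(real^'p \<Rightarrow> real) \<Rightarrow> (real^'p \<Rightarrow> (real^'p) set) \<Rightarrow> (real^'p) set \<Rightarrow>
     real \<Rightarrow> real^'p \<Rightarrow> bool" where
  "eps_solution F A Z \<epsilon> z \<longleftrightarrow> z \<in> interior Z \<and> dist_zero F z (A z) \<le> ereal \<epsilon>"

end

theory Submission
  imports Defs
begin

text \<open>
A point \<open>z\<close> is central for \<open>t\<close> iff \<open>- t \<nabla>F(z) \<in> A z\<close>. Uniqueness holds because \<open>\<nabla>F\<close> is strictly
monotone (its derivative, the Hessian, is positive definite) while \<open>A\<close> is monotone. For the
distance estimate, \<open>- t \<nabla>F(z)\<close> is itself an element of \<open>A z\<close>, and its dual local norm is at
most \<open>t * sqrt \<nu>\<close> because \<open>\<nu>\<close> bounds the squared dual norm of \<open>\<nabla>F(z)\<close>; the minimum defining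
the distance exists since \<open>A z\<close> is closed.

Existence is the substantial part. Minty's theorem (\<open>resolvent_exists\<close>) provides the
nonexpansive resolvent \<open>J = (I + A)\<^sup>-\<^sup>1\<close>. Adding a quadratic regularization \<open>(e/2) \<parallel>z\<parallel>\<^sup>2\<close> to
\<open>t F\<close> gives a convex function with compact sublevel sets, and Brouwer's theorem, applied to
a forward-backward step followed by projection onto such a set, produces a zero of \<open>A\<close> plus
the regularized gradient (\<open>exists_zero_of_sum_with_gradient\<close>).

As \<open>e \<rightarrow> 0\<close> these zeros must not escape. The interior of \<open>Z\<close> intersected with the domain of \<open>A\<close>
has convex closure, so the directions of an unbounded sequence of zeros accumulate at an
element \<open>\<omega>\<close> of its horizon cone. The barrier inequality \<open>\<nabla>F(z) \<bullet> (y - z) \<le> \<nu>\<close>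
(\<open>grad_inner_le_nu\<close>) and monotonicity of \<open>A\<close> bound \<open>a \<bullet> z\<close> from above along the sequence for
each fixed \<open>a \<in> A y\<close> with \<open>y\<close> interior, which forces \<open>a \<bullet> \<omega> \<le> 0\<close> and contradicts the
hypothesis on horizon directions. A bounded sequence of zeros has bounded barrier values,
so it stays away from the frontier and converges along a subsequence to a central point.
\<close>

section \<open>Maximally monotone operators and their resolvents\<close>

lemma maximally_monotoneD:
  assumes "maximally_monotone A" "u \<in> A x" "v \<in> A y"
  shows "(u - v) \<bullet> (x - y) \<ge> 0"
  using assms unfolding maximally_monotone_def monotone_op_def by blast

text \<open>Maximality in the form in which it is used: a pair that is monotonically related to every
pair of the graph can be added to the graph without destroying monotonicity, so it is
already there.\<close>
lemma maximally_monotone_memI: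
  fixes A :: "real^'p \<Rightarrow> (real^'p) set"
  assumes "maximally_monotone A"
    and rel: "\<And>y a. a \<in> A y \<Longrightarrow> (w - a) \<bullet> (z - y) \<ge> 0"
  shows "w \<in> A z"
proof -
  define B where "B = A(z := insert w (A z))"
  have "monotone_op B"
    unfolding monotone_op_def
  proof (intro allI ballI)
    fix x y u v
    assume u: "u \<in> B x" and v: "v \<in> B y"
    consider "u \<in> A x" "v \<in> A y" | "u = w" "x = z" "v \<in> A y" | "u \<in> A x" "v = w" "y = z"
      | "u = w" "x = z" "v = w" "y = z"
      using u v unfolding B_def by (auto split: if_splits)
    then show "(u - v) \<bullet> (x - y) \<ge> 0"
    proof cases
      case 1 then show ?thesis using maximally_monotoneD[OF assms(1)] by blast
    next
      case 2 then show ?thesis using rel by blast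
    next
      case 3
      then have "(w - u) \<bullet> (z - x) \<ge> 0" using rel by blast
      moreover have "(u - w) \<bullet> (x - z) = (w - u) \<bullet> (z - x)"
        by (simp add: inner_diff_left inner_diff_right)
      ultimately show ?thesis using 3 by simp
    qed auto
  qed
  moreover have "\<forall>x. A x \<subseteq> B x" unfolding B_def by auto
  ultimately have "B = A" using assms(1) unfolding maximally_monotone_def by blast
  then show ?thesis unfolding B_def by (metis fun_upd_same insertI1)
qed

lemma maximally_monotone_closed_graph:
  fixes A :: "real^'p \<Rightarrow> (real^'p) set"
  assumes "maximally_monotone A" "\<And>n. u n \<in> A (x n)" "u \<longlonglongrightarrow> w" "x \<longlonglongrightarrow> z"
  shows "w \<in> A z"
proof (rule maximally_monotone_memI[OF assms(1)])
  fix y a assume a: "a \<in> A y"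
  have "(\<lambda>n. (u n - a) \<bullet> (x n - y)) \<longlonglongrightarrow> (w - a) \<bullet> (z - y)"
    by (intro tendsto_intros assms)
  then show "(w - a) \<bullet> (z - y) \<ge> 0"
    by (rule LIMSEQ_le_const) (use maximally_monotoneD[OF assms(1) assms(2) a] in blast)
qed

text \<open>The function \<open>s - b \<bullet> y\<close> vanishes at the lifted points \<open>(y, b, b \<bullet> y)\<close> but is not convex, so
its sign on their convex hull is not immediate. Monotonicity says that its polarization
\<open>s + s' - b' \<bullet> y - b \<bullet> y'\<close> is nonnegative at any two lifted points; being affine in each
argument, the polarization stays nonnegative on the hull in one argument and then in the
other, and on the diagonal it is \<open>2 * (s - b \<bullet> y)\<close>.\<close>
lemma monotone_hull_ineq:
  fixes M :: "('a::euclidean_space \<times> 'a) set"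
  assumes mono: "\<And>y b y' b'. (y,b) \<in> M \<Longrightarrow> (y',b') \<in> M \<Longrightarrow> (b - b') \<bullet> (y - y') \<ge> 0"
    and w: "(y,b,s) \<in> convex hull ((\<lambda>(y,b). (y, b, b \<bullet> y)) ` M)"
  shows "b \<bullet> y \<le> s"
proof -
  define E where "E = (\<lambda>(y,b). (y, b, b \<bullet> y)) ` M"
  have convex_half: "convex {w :: 'a \<times> 'a \<times> real. (- d, - c, 1) \<bullet> w \<ge> e}" for c d e
    using convex_halfspace_ge by blast
  \<comment> \<open>An affine inequality on the lifted points passes to their convex hull.\<close>
  have halfspace: "w' \<in> {w. (- d, - c, 1) \<bullet> w \<ge> e}"
    if "\<And>w. w \<in> E \<Longrightarrow> (- d, - c, 1) \<bullet> w \<ge> e" "w' \<in> convex hull E" for c d e w'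
    using hull_minimal[of E "{w. (- d, - c, 1) \<bullet> w \<ge> e}" convex] that convex_half by blast
  have 1: "(- b', - y', 1) \<bullet> (y, b, s) \<ge> - (b' \<bullet> y')" if "(y',b') \<in> M" for y' b'
  proof -
    have "(- b', - y', 1) \<bullet> w \<ge> - (b' \<bullet> y')" if "w \<in> E" for w
      using that mono[OF _ \<open>(y',b') \<in> M\<close>] unfolding E_def
      by (fastforce simp: inner_diff_left inner_diff_right inner_commute)
    then show ?thesis using halfspace[where w' = "(y,b,s)"] w unfolding E_def by blast
  qed
  have "(- b, - y, 1) \<bullet> w \<ge> - s" if "w \<in> E" for w
    using that 1 unfolding E_def by (fastforce simp: inner_commute)
  then have "(- b, - y, 1) \<bullet> (y,b,s) \<ge> - s"
    using halfspace[where w' = "(y,b,s)"] w unfolding E_def by blast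
  then show ?thesis by (simp add: inner_commute)
qed

lemma nonneg_if_quadratic_nonneg_near_0:
  fixes c k :: real
  assumes "\<And>\<theta>. 0 < \<theta> \<Longrightarrow> \<theta> \<le> 1 \<Longrightarrow> \<theta> * c + \<theta>\<^sup>2 * k \<ge> 0"
  shows "c \<ge> 0"
proof -
  have "((\<lambda>\<theta>. c + \<theta> * k) \<longlongrightarrow> c + 0 * k) (at_right 0)"
    by (intro tendsto_intros)
  moreover have "eventually (\<lambda>\<theta>. c + \<theta> * k \<ge> 0) (at_right 0)"
  proof (rule eventually_at_rightI[of 0 1])
    fix \<theta> :: real assume \<theta>: "\<theta> \<in> {0<..<1}"
    have "\<theta> * (c + \<theta> * k) \<ge> 0" using assms[of \<theta>] \<theta> by (simp add: algebra_simps power2_eq_square)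
    then show "c + \<theta> * k \<ge> 0" using \<theta> by (simp add: zero_le_mult_iff)
  qed simp
  ultimately have "c + 0 * k \<ge> 0"
    by (intro tendsto_lowerbound) auto
  then show ?thesis by simp
qed

text \<open>For finite \<open>M\<close>, the point \<open>z\<close> comes from a minimum. Put \<open>q (y, b) = (y - b) / 2\<close> and minimize
\<open>\<parallel>q\<parallel>\<^sup>2 + s\<close> over the convex hull of the points \<open>(y, b, b \<bullet> y)\<close>. If the minimizer is
\<open>(y\<^sub>0, b\<^sub>0, s\<^sub>0)\<close> and \<open>z = q (y\<^sub>0, b\<^sub>0)\<close>, the first-order condition in the direction of a
point of \<open>M\<close> reads \<open>(b + z) \<bullet> (y - z) \<ge> \<parallel>z\<parallel>\<^sup>2 + s\<^sub>0\<close>, and the right-hand side is at least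
\<open>\<parallel>y\<^sub>0 + b\<^sub>0\<parallel>\<^sup>2 / 4\<close> because \<open>b\<^sub>0 \<bullet> y\<^sub>0 \<le> s\<^sub>0\<close> on the hull.\<close>
lemma minty_finite:
  fixes M :: "('a::euclidean_space \<times> 'a) set"
  assumes "finite M" "M \<noteq> {}"
    and mono: "\<And>y b y' b'. (y,b) \<in> M \<Longrightarrow> (y',b') \<in> M \<Longrightarrow> (b - b') \<bullet> (y - y') \<ge> 0"
  shows "\<exists>z. \<forall>(y,b)\<in>M. (b + z) \<bullet> (y - z) \<ge> 0"
proof -
  define E where "E = (\<lambda>(y,b). (y, b, b \<bullet> y)) ` M"
  define q :: "'a \<times> 'a \<times> real \<Rightarrow> 'a" where "q = (\<lambda>(y,b,s). (1/2) *\<^sub>R (y - b))"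
  define h where "h = (\<lambda>w. q w \<bullet> q w + snd (snd w))"
  have lin: "linear q" unfolding q_def
    by (rule linearI) (auto simp: algebra_simps)
  have "compact (convex hull E)"
    unfolding E_def by (intro finite_imp_compact_convex_hull finite_imageI assms)
  moreover have "convex hull E \<noteq> {}" using assms unfolding E_def by simp
  moreover have "continuous_on (convex hull E) h"
    unfolding h_def using lin
    by (intro continuous_intros linear_continuous_on) (simp_all add: linear_conv_bounded_linear)
  ultimately obtain w where w: "w \<in> convex hull E" and min: "\<And>w'. w' \<in> convex hull E \<Longrightarrow> h w \<le> h w'"
    using continuous_attains_inf by metis
  obtain y0 b0 s0 where w_eq: "w = (y0,b0,s0)" by (cases w) auto
  have "b0 \<bullet> y0 \<le> s0"
    by (rule monotone_hull_ineq[OF mono]) (use w w_eq E_def in auto)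
  define z where "z = q w"
  have z_eq: "z = (1/2) *\<^sub>R (y0 - b0)" unfolding z_def q_def w_eq by simp
  have "z \<bullet> z + s0 \<ge> 0"
  proof -
    have "z \<bullet> z + b0 \<bullet> y0 = ((1/2) *\<^sub>R (y0 + b0)) \<bullet> ((1/2) *\<^sub>R (y0 + b0))"
      unfolding z_eq inner_scaleR_left inner_scaleR_right inner_diff_left inner_diff_right inner_add_left inner_add_right
      by (simp add: inner_commute field_simps)
    then show ?thesis using \<open>b0 \<bullet> y0 \<le> s0\<close> by (metis add_left_mono inner_ge_zero order_trans)
  qed
  have "(b + z) \<bullet> (y - z) \<ge> 0" if yb: "(y,b) \<in> M" for y b
  proof -
    define w' where "w' = (y, b, b \<bullet> y)"
    have w': "w' \<in> convex hull E"
      using yb unfolding w'_def E_def by (intro hull_inc) force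
    \<comment> \<open>First-order optimality at \<open>w\<close> in the direction \<open>w' - w\<close>.\<close>
    have "2 * (z \<bullet> (q w' - z)) + (b \<bullet> y - s0) \<ge> 0"
    proof (rule nonneg_if_quadratic_nonneg_near_0)
      fix \<theta> :: real assume \<theta>: "0 < \<theta>" "\<theta> \<le> 1"
      have mem: "w + \<theta> *\<^sub>R (w' - w) \<in> convex hull E"
        using convexD_alt[OF convex_convex_hull w w', of \<theta>] \<theta> by (simp add: algebra_simps)
      have q_eq: "q (w + \<theta> *\<^sub>R (w' - w)) = z + \<theta> *\<^sub>R (q w' - z)"
        unfolding z_def using lin by (simp add: linear_add linear_cmul linear_diff)
      have s_eq: "snd (snd (w + \<theta> *\<^sub>R (w' - w))) = s0 + \<theta> * (b \<bullet> y - s0)"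
        unfolding w_eq w'_def by simp
      have hw: "h w = z \<bullet> z + s0" unfolding h_def z_def w_eq by simp
      have "h (w + \<theta> *\<^sub>R (w' - w)) - h w =
         \<theta> * (2 * (z \<bullet> (q w' - z)) + (b \<bullet> y - s0)) + \<theta>\<^sup>2 * ((q w' - z) \<bullet> (q w' - z))"
        unfolding hw unfolding h_def q_eq s_eq
        by (simp add: inner_commute power2_eq_square algebra_simps)
      then show "\<theta> * (2 * (z \<bullet> (q w' - z)) + (b \<bullet> y - s0)) + \<theta>\<^sup>2 * ((q w' - z) \<bullet> (q w' - z)) \<ge> 0"
        using min[OF mem] by simp
    qed
    moreover have "(b + z) \<bullet> (y - z) = 2 * (z \<bullet> (q w' - z)) + (b \<bullet> y - s0) + (z \<bullet> z + s0)"
      unfolding w'_def q_def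
      by (simp add: inner_diff_left inner_diff_right inner_add_left inner_add_right inner_commute algebra_simps)
    ultimately show ?thesis using \<open>z \<bullet> z + s0 \<ge> 0\<close> by linarith
  qed
  then show ?thesis by blast
qed

text \<open>Completing the square: each condition on \<open>z\<close> in Minty's theorem describes a closed ball,
which supplies the compactness for passing from finite to arbitrary monotone sets.\<close>
lemma inner_ge_0_iff_mem_cball:
  fixes z :: "'a::real_inner"
  shows "(b + z) \<bullet> (y - z) \<ge> 0 \<longleftrightarrow> z \<in> cball ((1/2) *\<^sub>R (y - b)) (norm ((1/2) *\<^sub>R (y + b)))"
proof -
  have "z \<in> cball ((1/2) *\<^sub>R (y - b)) (norm ((1/2) *\<^sub>R (y + b))) \<longleftrightarrow>
    ((1/2) *\<^sub>R (y - b) - z) \<bullet> ((1/2) *\<^sub>R (y - b) - z) \<le> ((1/2) *\<^sub>R (y + b)) \<bullet> ((1/2) *\<^sub>R (y + b))"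
    unfolding mem_cball dist_norm norm_le ..
  also have "((1/2) *\<^sub>R (y - b) - z) \<bullet> ((1/2) *\<^sub>R (y - b) - z) =
      ((1/2) *\<^sub>R (y + b)) \<bullet> ((1/2) *\<^sub>R (y + b)) - (b + z) \<bullet> (y - z)"
    unfolding inner_scaleR_left inner_scaleR_right inner_diff_left inner_diff_right inner_add_left inner_add_right
    by (simp add: inner_commute field_simps)
  finally show ?thesis by simp
qed

text \<open>Equivalently, any monotone set \<open>M\<close> can be extended monotonically by a pair \<open>(z, -z)\<close>. The
conditions are closed balls, any finitely many of which meet.\<close>
lemma minty_extension:
  fixes M :: "('a::euclidean_space \<times> 'a) set"
  assumes mono: "\<And>y b y' b'. (y,b) \<in> M \<Longrightarrow> (y',b') \<in> M \<Longrightarrow> (b - b') \<bullet> (y - y') \<ge> 0"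
  shows "\<exists>z. \<forall>(y,b)\<in>M. (b + z) \<bullet> (y - z) \<ge> 0"
proof (cases "M = {}")
  case False
  then obtain m0 where m0: "m0 \<in> M" by blast
  define S where "S = (\<lambda>(y::'a,b). cball ((1/2) *\<^sub>R (y - b)) (norm ((1/2) *\<^sub>R (y + b))))"
  have S_iff: "z \<in> S (y,b) \<longleftrightarrow> (b + z) \<bullet> (y - z) \<ge> 0" for z y b
    unfolding S_def using inner_ge_0_iff_mem_cball by auto
  have "S m0 \<inter> \<Inter> (S ` M) \<noteq> {}"
  proof (rule compact_imp_fip)
    show "compact (S m0)" unfolding S_def by (simp add: split_beta)
    show "closed T" if "T \<in> S ` M" for T using that unfolding S_def by auto
  next
    fix G assume "finite G" "G \<subseteq> S ` M"
    then obtain N where N: "N \<subseteq> M" "finite N" "G = S ` N" by (meson finite_subset_image)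
    have "\<exists>z. \<forall>(y,b)\<in>insert m0 N. (b + z) \<bullet> (y - z) \<ge> 0"
      by (rule minty_finite) (use N m0 mono in blast)+
    then obtain z where "\<forall>(y,b)\<in>insert m0 N. (b + z) \<bullet> (y - z) \<ge> 0" by blast
    then have "\<forall>m\<in>insert m0 N. z \<in> S m" using S_iff by auto
    then show "S m0 \<inter> \<Inter> G \<noteq> {}" using N by blast
  qed
  then obtain z where "\<forall>m\<in>M. z \<in> S m" by blast
  then show ?thesis using S_iff by blast
qed simp

text \<open>Minty's theorem. A pair \<open>(z, -z)\<close> monotonically related to the graph of \<open>r A - x\<close> is, by
maximality, in that graph.\<close>
lemma resolvent_exists:
  fixes A :: "real^'p \<Rightarrow> (real^'p) set"
  assumes mm: "maximally_monotone A" and "r > 0"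
  shows "\<exists>z. (1/r) *\<^sub>R (x - z) \<in> A z"
proof -
  define M where "M = {(y, r *\<^sub>R a - x) | y a. a \<in> A y}"
  have "\<exists>z. \<forall>(y,b)\<in>M. (b + z) \<bullet> (y - z) \<ge> 0"
  proof (rule minty_extension)
    fix y b y' b' assume "(y,b) \<in> M" "(y',b') \<in> M"
    then obtain a a' where a: "b = r *\<^sub>R a - x" "b' = r *\<^sub>R a' - x" "a \<in> A y" "a' \<in> A y'"
      unfolding M_def by blast
    then have "b - b' = r *\<^sub>R (a - a')" unfolding a(1,2) scaleR_diff_right by simp
    then show "(b - b') \<bullet> (y - y') \<ge> 0"
      using maximally_monotoneD[OF mm a(3,4)] \<open>r > 0\<close> by simp
  qed
  then obtain z where z: "\<And>y b. (y,b) \<in> M \<Longrightarrow> (b + z) \<bullet> (y - z) \<ge> 0" by blast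
  have "(1/r) *\<^sub>R (x - z) \<in> A z"
  proof (rule maximally_monotone_memI[OF mm])
    fix y a assume "a \<in> A y"
    then have "(r *\<^sub>R a - x + z) \<bullet> (y - z) \<ge> 0" using z unfolding M_def by blast
    moreover have "(1/r) *\<^sub>R (x - z) - a = (- (1/r)) *\<^sub>R (r *\<^sub>R a - x + z)"
      using \<open>r > 0\<close> by (simp add: algebra_simps)
    then have "((1/r) *\<^sub>R (x - z) - a) \<bullet> (z - y) = (1/r) * ((r *\<^sub>R a - x + z) \<bullet> (y - z))"
      by (simp only: inner_scaleR_left) (simp add: inner_diff_right algebra_simps)
    ultimately show "((1/r) *\<^sub>R (x - z) - a) \<bullet> (z - y) \<ge> 0" using \<open>r > 0\<close> by simp
  qed
  then show ?thesis by blast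
qed

text \<open>The nonexpansive map \<open>J\<close> is \<open>(I + A)\<^sup>-\<^sup>1\<close>.\<close>
lemma resolvent_nonexpansive:
  fixes A :: "real^'p \<Rightarrow> (real^'p) set"
  assumes mm: "maximally_monotone A"
  obtains J where "\<And>x. x - J x \<in> A (J x)" "\<And>x y. norm (J x - J y) \<le> norm (x - y)"
proof -
  have "\<forall>x. \<exists>z. x - z \<in> A z" using resolvent_exists[OF mm, of 1] by simp
  then obtain J where J: "\<And>x. x - J x \<in> A (J x)" by metis
  have "norm (J x - J y) \<le> norm (x - y)" for x y
  proof -
    have "((x - J x) - (y - J y)) \<bullet> (J x - J y) \<ge> 0"
      using maximally_monotoneD[OF mm J J] .
    then have "(J x - J y) \<bullet> (J x - J y) \<le> (x - y) \<bullet> (J x - J y)"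
      by (simp add: inner_diff_left inner_diff_right)
    also have "\<dots> \<le> norm (x - y) * norm (J x - J y)" by (rule norm_cauchy_schwarz)
    finally have "norm (J x - J y) * norm (J x - J y) \<le> norm (x - y) * norm (J x - J y)"
      by (simp add: dot_square_norm power2_eq_square)
    then show ?thesis by (cases "J x = J y") auto
  qed
  then show thesis using J that by blast
qed

section \<open>The domain of a maximally monotone operator and its horizon\<close>

text \<open>A point \<open>x\<close> between two points of the domain is the limit of the resolvents
\<open>v = (I + r A)\<^sup>-\<^sup>1 x\<close> as \<open>r \<rightarrow> 0\<close>, and these lie in the domain. Indeed, taking the convex
combination of the monotonicity inequalities against the two endpoints makes the terms
without factor \<open>r\<close> collapse to \<open>- \<parallel>x - v\<parallel>\<^sup>2\<close>, so \<open>\<parallel>x - v\<parallel>\<^sup>2 = O(r)\<close>.\<close>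
lemma segment_subset_closure_op_dom:
  fixes A :: "real^'p \<Rightarrow> (real^'p) set"
  assumes mm: "maximally_monotone A" and "y \<in> op_dom A" "z \<in> op_dom A"
  shows "closed_segment y z \<subseteq> closure (op_dom A)"
proof
  fix x assume "x \<in> closed_segment y z"
  then obtain u where u: "0 \<le> u" "u \<le> 1" and x: "x = (1 - u) *\<^sub>R y + u *\<^sub>R z"
    unfolding closed_segment_def by blast
  obtain a b where a: "a \<in> A y" and b: "b \<in> A z" using assms unfolding op_dom_def by blast
  define c where "c = (1 - u) *\<^sub>R a + u *\<^sub>R b"
  define k where "k = (1 - u) * (a \<bullet> (y - x)) + u * (b \<bullet> (z - x))"
  define B where "B = (norm c)\<^sup>2 + 2 * \<bar>k\<bar>"
  have "B \<ge> 0" unfolding B_def by simp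
  show "x \<in> closure (op_dom A)"
    unfolding closure_approachable
  proof (intro allI impI)
    fix e :: real assume "e > 0"
    \<comment> \<open>The estimate below is \<open>\<parallel>x - v\<parallel>\<^sup>2 \<le> r * B\<close> for \<open>r \<le> 1\<close>.\<close>
    define r where "r = min 1 (e\<^sup>2 / (B + 1))"
    have r: "0 < r" "r \<le> 1" "r \<le> e\<^sup>2 / (B + 1)"
      unfolding r_def using \<open>e > 0\<close> \<open>B \<ge> 0\<close> by auto
    then have "r * (B + 1) \<le> e\<^sup>2" using \<open>B \<ge> 0\<close> by (simp add: pos_le_divide_eq)
    then have rB: "r * B < e\<^sup>2" using r by (simp add: algebra_simps)
    obtain v where v: "(1/r) *\<^sub>R (x - v) \<in> A v" using resolvent_exists[OF mm r(1)] by blast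
    define d where "d = x - v"
    have ineq: "d \<bullet> (v - y') \<ge> r * (a' \<bullet> (v - y'))" if "a' \<in> A y'" for a' y'
    proof -
      have "((1/r) *\<^sub>R d - a') \<bullet> (v - y') \<ge> 0"
        unfolding d_def by (rule maximally_monotoneD[OF mm v that])
      then have "r * (((1/r) *\<^sub>R d - a') \<bullet> (v - y')) \<ge> 0" using r by simp
      then show ?thesis using r by (simp add: inner_diff_left algebra_simps)
    qed
    have "(1 - u) * (r * (a \<bullet> (v - y))) + u * (r * (b \<bullet> (v - z)))
        \<le> (1 - u) * (d \<bullet> (v - y)) + u * (d \<bullet> (v - z))"
      using ineq[OF a] ineq[OF b] u by (intro add_mono mult_left_mono) auto
    also have "\<dots> = d \<bullet> (v - x)"
      unfolding x by (simp add: inner_diff_right inner_add_right algebra_simps)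
    also have "\<dots> = - (norm d)\<^sup>2"
      unfolding power2_norm_eq_inner d_def by (simp add: inner_diff_left inner_diff_right)
    also have "(1 - u) * (r * (a \<bullet> (v - y))) + u * (r * (b \<bullet> (v - z))) = - (r * (c \<bullet> d + k))"
      unfolding c_def k_def d_def
      by (simp add: inner_diff_right inner_diff_left inner_add_left inner_add_right algebra_simps)
    finally have "(norm d)\<^sup>2 \<le> r * (c \<bullet> d) + r * k" by (simp add: algebra_simps)
    also have "r * (c \<bullet> d) \<le> r * (norm c * norm d)"
      using r by (intro mult_left_mono norm_cauchy_schwarz) auto
    also have "\<dots> \<le> (r * norm c)\<^sup>2 / 2 + (norm d)\<^sup>2 / 2"
      using sum_squares_bound[of "r * norm c" "norm d"] by simp
    also have "(r * norm c)\<^sup>2 \<le> r * (norm c)\<^sup>2"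
      unfolding power_mult_distrib using r by (intro mult_right_mono) (simp_all add: power2_eq_square mult_left_le)
    also have "r * k \<le> r * \<bar>k\<bar>" using r by (intro mult_left_mono) auto
    finally have "(norm d)\<^sup>2 \<le> r * B" unfolding B_def by (simp add: algebra_simps)
    then have "(norm d)\<^sup>2 < e\<^sup>2" using rB by simp
    then have "dist v x < e"
      unfolding d_def dist_norm using \<open>e > 0\<close> by (simp add: norm_minus_commute power2_less_imp_less)
    moreover have "v \<in> op_dom A" using v unfolding op_dom_def by blast
    ultimately show "\<exists>y\<in>op_dom A. dist y x < e" by blast
  qed
qed

text \<open>
The set itself need not be convex. Its closure is, because a point of the open set \<open>D\<close> that is a
limit of points of the domain is already a limit of domain points in \<open>D\<close>.\<close>
lemma convex_closure_open_Int_op_dom: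
  fixes A :: "real^'p \<Rightarrow> (real^'p) set"
  assumes mm: "maximally_monotone A" and D: "open D" "convex D"
  shows "convex (closure (D \<inter> op_dom A))"
proof -
  have "convex (closure (op_dom A))"
  proof -
    define S where "S = closure (op_dom A)"
    have "u *\<^sub>R x + v *\<^sub>R y \<in> S" if "x \<in> S" "y \<in> S" "0 \<le> u" "0 \<le> v" "u + v = 1" for x y u v
    proof -
      obtain p where p: "\<And>n. p n \<in> op_dom A" "p \<longlonglongrightarrow> x"
        using \<open>x \<in> S\<close> unfolding S_def closure_sequential by blast
      obtain q where q: "\<And>n. q n \<in> op_dom A" "q \<longlonglongrightarrow> y"
        using \<open>y \<in> S\<close> unfolding S_def closure_sequential by blast
      have "u *\<^sub>R p n + v *\<^sub>R q n \<in> S" for n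
      proof -
        have "u = 1 - v" using that by simp
        then have "u *\<^sub>R p n + v *\<^sub>R q n \<in> closed_segment (p n) (q n)"
          unfolding closed_segment_def using that by (intro CollectI exI[of _ v]) auto
        then show ?thesis
          unfolding S_def using segment_subset_closure_op_dom[OF mm p(1) q(1)] by blast
      qed
      moreover have "(\<lambda>n. u *\<^sub>R p n + v *\<^sub>R q n) \<longlonglongrightarrow> u *\<^sub>R x + v *\<^sub>R y"
        by (intro tendsto_intros p q)
      ultimately show ?thesis
        using closed_sequentially[of S] unfolding S_def by (meson closed_closure)
    qed
    then show ?thesis unfolding S_def[symmetric] convex_def by blast
  qed
  then have "convex (D \<inter> closure (op_dom A))" using D by (simp add: convex_Int)
  then have "convex (closure (D \<inter> closure (op_dom A)))" by (rule convex_closure)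
  moreover have "closure (D \<inter> closure (op_dom A)) = closure (D \<inter> op_dom A)"
  proof
    show "closure (D \<inter> closure (op_dom A)) \<subseteq> closure (D \<inter> op_dom A)"
      by (intro closure_minimal open_Int_closure_subset D closed_closure)
    show "closure (D \<inter> op_dom A) \<subseteq> closure (D \<inter> closure (op_dom A))"
      using closure_subset[of "op_dom A"] by (intro closure_mono) blast
  qed
  ultimately show ?thesis by simp
qed

text \<open>Compactness at infinity: if \<open>S\<close> were unbounded, the directions of points of \<open>S\<close> going to
infinity would accumulate at a unit vector \<open>\<omega>\<close>. Convexity of the closure puts \<open>\<omega>\<close> into the
horizon cone, and dividing \<open>a \<bullet> z \<le> B\<close> by \<open>\<parallel>z\<parallel>\<close> shows \<open>a \<bullet> \<omega> \<le> 0\<close> for every \<open>a\<close> in the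
range of \<open>A\<close> over \<open>C\<close>.\<close>
lemma bounded_if_no_horizon_direction:
  fixes A :: "real^'p \<Rightarrow> (real^'p) set"
  assumes conv: "convex (closure C)" and "S \<subseteq> C"
    and hor: "\<And>\<omega>. \<omega> \<in> horizon_cone C \<Longrightarrow> \<omega> \<noteq> 0 \<Longrightarrow> \<exists>y\<in>C. \<exists>a\<in>A y. a \<bullet> \<omega> > 0"
    and bd: "\<And>y a. y \<in> C \<Longrightarrow> a \<in> A y \<Longrightarrow> \<exists>B. \<forall>z\<in>S. a \<bullet> z \<le> B"
  shows "bounded S"
proof (rule ccontr)
  assume "\<not> bounded S"
  then have "\<forall>k::nat. \<exists>z\<in>S. norm z > real k" unfolding bounded_iff by (meson not_le)
  then obtain z where z: "\<And>k. z k \<in> S" "\<And>k. norm (z k) > real k" by metis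
  define w where "w = (\<lambda>k. (1 / norm (z k)) *\<^sub>R z k)"
  have "norm (z k) > 0" for k using z(2)[of k] by linarith
  then have "w k \<in> sphere 0 1" for k unfolding w_def by simp
  then obtain \<omega> r where \<omega>: "\<omega> \<in> sphere 0 1" and r: "strict_mono r" and lim: "(w \<circ> r) \<longlonglongrightarrow> \<omega>"
    using compact_sphere[of "0::real^'p" 1] unfolding compact_def by metis
  define N where "N = (\<lambda>k. norm (z (r k)))"
  have N_ge: "N k > real k" for k
    using z(2)[of "r k"] seq_suble[OF r, of k] unfolding N_def by linarith
  then have "N k > 0" for k by (meson of_nat_0_le_iff order_le_less_trans)
  have "filterlim N at_top sequentially"
    by (rule filterlim_at_top_mono[OF filterlim_real_sequentially])
      (use N_ge less_imp_le in \<open>auto intro!: always_eventually\<close>)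
  then have N0: "(\<lambda>k. c / N k) \<longlonglongrightarrow> 0" for c
    by (intro tendsto_divide_0[OF tendsto_const] filterlim_at_top_imp_at_infinity)
  have zN: "z (r k) = N k *\<^sub>R (w \<circ> r) k" for k
    using \<open>N k > 0\<close> unfolding N_def w_def by simp
  have "\<omega> \<in> horizon_cone C"
    unfolding horizon_cone_def
  proof (intro CollectI ballI allI impI)
    fix y and \<tau> :: real assume "y \<in> C" "\<tau> > 0"
    define p where "p = (\<lambda>k. (1 - \<tau> / N k) *\<^sub>R y + (\<tau> / N k) *\<^sub>R z (r k))"
    have "p = (\<lambda>k. (1 - \<tau> / N k) *\<^sub>R y + \<tau> *\<^sub>R (w \<circ> r) k)"
      unfolding p_def zN using \<open>\<And>k. N k > 0\<close> by (auto simp: less_imp_neq[THEN not_sym])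
    moreover have "(\<lambda>k. (1 - \<tau> / N k) *\<^sub>R y + \<tau> *\<^sub>R (w \<circ> r) k) \<longlonglongrightarrow> (1 - 0) *\<^sub>R y + \<tau> *\<^sub>R \<omega>"
      by (intro tendsto_intros N0 lim)
    ultimately have "p \<longlonglongrightarrow> y + \<tau> *\<^sub>R \<omega>" by simp
    moreover have "eventually (\<lambda>k. p k \<in> closure C) sequentially"
    proof -
      have "eventually (\<lambda>k. \<tau> / N k < 1) sequentially"
        using order_tendstoD(2)[OF N0] by simp
      then show ?thesis
      proof (rule eventually_mono)
        fix k assume "\<tau> / N k < 1"
        moreover have "y \<in> closure C" "z (r k) \<in> closure C"
          using \<open>y \<in> C\<close> z(1) \<open>S \<subseteq> C\<close> closure_subset by blast+
        ultimately show "p k \<in> closure C"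
          unfolding p_def using \<open>\<tau> > 0\<close> \<open>N k > 0\<close> by (intro convexD_alt[OF conv]) auto
      qed
    qed
    ultimately show "y + \<tau> *\<^sub>R \<omega> \<in> closure C"
      using Lim_in_closed_set[OF closed_closure _ sequentially_bot] by blast
  qed
  moreover have "\<omega> \<noteq> 0" using \<omega> by auto
  ultimately obtain y a where a: "y \<in> C" "a \<in> A y" "a \<bullet> \<omega> > 0" using hor by blast
  obtain B where B: "\<And>v. v \<in> S \<Longrightarrow> a \<bullet> v \<le> B" using bd[OF a(1,2)] by blast
  have "a \<bullet> (w \<circ> r) k \<le> B / N k" for k
    using B[OF z(1)[of "r k"]] \<open>N k > 0\<close> unfolding zN by (simp add: field_simps)
  moreover have "(\<lambda>k. a \<bullet> (w \<circ> r) k) \<longlonglongrightarrow> a \<bullet> \<omega>" by (intro tendsto_intros lim)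
  ultimately have "a \<bullet> \<omega> \<le> 0" using N0[of B] by (meson LIMSEQ_le)
  then show False using a by simp
qed

section \<open>Zeros of the sum of a maximally monotone operator and a gradient\<close>

text \<open>With \<open>J = (I + A)\<^sup>-\<^sup>1\<close>, a point \<open>p\<close> satisfies \<open>- g p \<in> A p\<close> iff \<open>J (p - g p) = p\<close>. The map
\<open>p \<mapsto> J (p - g p)\<close> need not preserve \<open>D\<close>, so it is followed by the projection \<open>P\<close> onto
the compact convex sublevel set \<open>K\<close> of \<open>\<Phi> = \<Psi> + a\<^sub>0 \<bullet> z\<close> through \<open>y\<^sub>0\<close>; Brouwer's theorem
gives \<open>p = P z\<close> with \<open>z = J (p - g p)\<close>. It remains to see that the projection did nothing.
If \<open>z \<noteq> p\<close>, the ray from \<open>p\<close> through \<open>z\<close> meets \<open>K\<close> only in \<open>p\<close>, so \<open>\<Phi>\<close> is at least \<open>\<Phi> y\<^sub>0\<close>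
at \<open>p\<close> and does not decrease towards \<open>z\<close>. Testing the monotonicity of \<open>A\<close> at \<open>z\<close> against
\<open>(y\<^sub>0, a\<^sub>0)\<close> then yields \<open>\<parallel>z - p\<parallel>\<^sup>2 \<le> \<Phi> y\<^sub>0 - \<Phi> p \<le> 0\<close>. The linear term \<open>a\<^sub>0 \<bullet> z\<close> is what
makes the estimate close without constants: it absorbs \<open>a\<^sub>0\<close> into the gradient of \<open>\<Phi>\<close>.\<close>
lemma exists_zero_of_sum_with_gradient:
  fixes A :: "real^'p \<Rightarrow> (real^'p) set"
  assumes mm: "maximally_monotone A" and D: "open D" "convex D"
    and der: "\<And>z. z \<in> D \<Longrightarrow> GDERIV \<Psi> z :> g z"
    and cont: "continuous_on D g"
    and supp: "\<And>z y. z \<in> D \<Longrightarrow> y \<in> D \<Longrightarrow> \<Psi> z + g z \<bullet> (y - z) \<le> \<Psi> y"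
    and y0: "y0 \<in> D" "a0 \<in> A y0"
    and comp: "compact {z \<in> D. \<Psi> z + a0 \<bullet> z \<le> \<Psi> y0 + a0 \<bullet> y0}"
  shows "\<exists>z\<in>D. - g z \<in> A z"
proof -
  define \<Phi> where "\<Phi> = (\<lambda>z. \<Psi> z + a0 \<bullet> z)"
  define K where "K = {z \<in> D. \<Phi> z \<le> \<Phi> y0}"
  have K: "compact K" using comp unfolding K_def \<Phi>_def .
  have "y0 \<in> K" using y0 unfolding K_def by simp
  have supp': "\<Phi> z + (g z + a0) \<bullet> (y - z) \<le> \<Phi> y" if "z \<in> D" "y \<in> D" for z y
    using supp[OF that] unfolding \<Phi>_def by (simp add: inner_diff_right inner_add_left)
  have "convex K"
    unfolding convex_def
  proof (intro ballI allI impI)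
    fix x y and u v :: real assume xy: "x \<in> K" "y \<in> K" and uv: "0 \<le> u" "0 \<le> v" "u + v = 1"
    define w where "w = u *\<^sub>R x + v *\<^sub>R y"
    have "w \<in> D" using convexD[OF D(2), of x y u v] xy uv unfolding K_def w_def by auto
    have "u * (\<Phi> w + (g w + a0) \<bullet> (x - w)) + v * (\<Phi> w + (g w + a0) \<bullet> (y - w)) \<le> u * \<Phi> y0 + v * \<Phi> y0"
      using supp'[OF \<open>w \<in> D\<close>, of x] supp'[OF \<open>w \<in> D\<close>, of y] xy uv unfolding K_def
      by (intro add_mono mult_left_mono) auto
    moreover have "u * (\<Phi> w + (g w + a0) \<bullet> (x - w)) + v * (\<Phi> w + (g w + a0) \<bullet> (y - w))
       = (u + v) * \<Phi> w + (g w + a0) \<bullet> (u *\<^sub>R x + v *\<^sub>R y - (u + v) *\<^sub>R w)"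
      by (simp add: algebra_simps inner_diff_right inner_add_right)
    ultimately have "\<Phi> w \<le> \<Phi> y0" using uv unfolding w_def by (simp flip: distrib_right)
    then show "u *\<^sub>R x + v *\<^sub>R y \<in> K" using \<open>w \<in> D\<close> unfolding K_def w_def by simp
  qed
  obtain J where J: "\<And>x. x - J x \<in> A (J x)" "\<And>x y. norm (J x - J y) \<le> norm (x - y)"
    using resolvent_nonexpansive[OF mm] by blast
  have contJ: "continuous_on UNIV J"
    unfolding continuous_on_iff dist_norm using J(2) by (meson order_le_less_trans)
  define P where "P = closest_point K"
  have closed: "closed K" using K compact_imp_closed by blast
  have contP: "continuous_on UNIV P"
    unfolding P_def using \<open>convex K\<close> closed \<open>y0 \<in> K\<close> by (intro continuous_on_closest_point) auto
  have "continuous_on K g" using cont by (rule continuous_on_subset) (auto simp: K_def)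
  then have "continuous_on K (\<lambda>p. p - g p)" by (intro continuous_intros)
  then have "continuous_on K (\<lambda>p. J (p - g p))"
    by (rule continuous_on_compose2[OF contJ]) simp
  then have "continuous_on K (\<lambda>p. P (J (p - g p)))"
    by (rule continuous_on_compose2[OF contP]) simp
  moreover have "(\<lambda>p. P (J (p - g p))) \<in> K \<rightarrow> K"
    unfolding P_def using closest_point_in_set[OF closed] \<open>y0 \<in> K\<close> by blast
  ultimately obtain p where p: "p \<in> K" "P (J (p - g p)) = p"
    using brouwer[OF K \<open>convex K\<close>, of "\<lambda>p. P (J (p - g p))"] \<open>y0 \<in> K\<close> by blast
  define z where "z = J (p - g p)"
  have Az: "p - g p - z \<in> A z" unfolding z_def by (rule J)
  have proj: "(z - p) \<bullet> (q - p) \<le> 0" if "q \<in> K" for q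
    using closest_point_dot[OF \<open>convex K\<close> closed that, of z] p unfolding P_def z_def by simp
  have "p \<in> D" using p unfolding K_def by blast
  have "z = p"
  proof (rule ccontr)
    assume "z \<noteq> p"
    have pos: "(z - p) \<bullet> (z - p) > 0" using \<open>z \<noteq> p\<close> by simp
    define l where "l = (\<lambda>s. p + s *\<^sub>R (z - p))"
    have outside: "l s \<notin> K" if "s > 0" for s
      using proj[of "l s"] pos that unfolding l_def by (auto simp: mult_le_0_iff)
    have "isCont l 0" unfolding l_def by (intro continuous_intros)
    then have "(l \<longlongrightarrow> p) (at 0)" unfolding isCont_def by (simp add: l_def)
    then have liml: "(l \<longlongrightarrow> p) (at_right 0)" by (rule tendsto_within_subset) simp
    then have inD: "eventually (\<lambda>s. l s \<in> D) (at_right 0)"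
      using D(1) \<open>p \<in> D\<close> topological_tendstoD by blast
    have der\<Phi>: "GDERIV \<Phi> p :> g p + a0"
      unfolding \<Phi>_def using der[OF \<open>p \<in> D\<close>]
      by (auto simp: gderiv_def inner_add_right inner_commute intro!: derivative_eq_intros)
    have ge: "eventually (\<lambda>s. \<Phi> (l s) \<ge> \<Phi> y0) (at_right 0)"
      using inD eventually_at_right_less[of 0]
    proof eventually_elim
      case (elim s) then show ?case using outside[of s] unfolding K_def by force
    qed
    have "isCont \<Phi> p" using der\<Phi> unfolding gderiv_def by (rule has_derivative_continuous)
    then have "((\<lambda>s. \<Phi> (l s)) \<longlongrightarrow> \<Phi> p) (at_right 0)" using liml by (rule isCont_tendsto_compose)
    then have "\<Phi> p \<ge> \<Phi> y0" using ge by (rule tendsto_lowerbound) simp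
    have "(g p + a0) \<bullet> (z - p) \<ge> 0"
    proof (rule ccontr)
      assume neg: "\<not> ?thesis"
      have "((\<lambda>s. \<Phi> (l s)) has_derivative (\<lambda>s. (s *\<^sub>R (z - p)) \<bullet> (g p + a0))) (at 0)"
        by (rule has_derivative_compose[where g = \<Phi>])
          (use der\<Phi> in \<open>auto simp: l_def gderiv_def intro!: derivative_eq_intros\<close>)
      then have "((\<lambda>s. \<Phi> (l s)) has_real_derivative (g p + a0) \<bullet> (z - p)) (at 0)"
        unfolding has_field_derivative_def by (rule has_derivative_eq_rhs) (auto simp: inner_commute)
      from DERIV_neg_dec_right[OF this] neg obtain e where
        e: "e > 0" "\<And>s. s > 0 \<Longrightarrow> s < e \<Longrightarrow> \<Phi> (l s) < \<Phi> p" unfolding l_def by auto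
      have "eventually (\<lambda>s. \<Phi> (l s) < \<Phi> p) (at_right 0)"
        using e by (auto intro: eventually_at_rightI[of 0 e])
      then have "eventually (\<lambda>s. \<Phi> (l s) < \<Phi> y0) (at_right 0)"
        by (rule eventually_mono) (use p in \<open>auto simp: K_def\<close>)
      with ge have "eventually (\<lambda>s::real. False) (at_right 0)" by eventually_elim simp
      then show False by simp
    qed
    moreover have "(p - g p - z - a0) \<bullet> (z - y0) \<ge> 0"
      by (rule maximally_monotoneD[OF mm Az y0(2)])
    moreover have "(g p + a0) \<bullet> (p - y0) \<ge> \<Phi> p - \<Phi> y0"
      using supp'[OF \<open>p \<in> D\<close> y0(1)] by (simp add: inner_diff_right)
    moreover have "(z - p) \<bullet> (y0 - p) \<le> 0" using proj[OF \<open>y0 \<in> K\<close>] .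
    moreover have "(p - g p - z - a0) \<bullet> (z - y0) =
        - ((z - p) \<bullet> (z - p)) + (z - p) \<bullet> (y0 - p) - (g p + a0) \<bullet> (z - p) - (g p + a0) \<bullet> (p - y0)"
      by (simp add: inner_diff_left inner_diff_right inner_add_left inner_add_right inner_commute)
    ultimately have "(z - p) \<bullet> (z - p) \<le> 0" using \<open>\<Phi> p \<ge> \<Phi> y0\<close> by linarith
    then show False using pos by simp
  qed
  then show ?thesis using Az \<open>p \<in> D\<close> by auto
qed

section \<open>Gradients, positive definite forms and the dual local distance\<close>

lemma GDERIV_grad:
  fixes F :: "real^'p \<Rightarrow> real"
  assumes "F differentiable (at z)"
  shows "GDERIV F z :> grad F z"
proof -
  obtain L where L: "(F has_derivative L) (at z)" using assms unfolding differentiable_def by blast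
  have "L = (\<lambda>h. h \<bullet> adjoint L 1)"
    using adjoint_works[OF has_derivative_linear[OF L]] by auto
  then have ex: "GDERIV F z :> adjoint L 1" using L unfolding gderiv_def by simp
  have "g = adjoint L 1" if "GDERIV F z :> g" for g
  proof -
    have "(\<lambda>h. h \<bullet> g) = (\<lambda>h. h \<bullet> adjoint L 1)"
      using that ex unfolding gderiv_def by (rule has_derivative_unique)
    then show ?thesis by (metis vector_eq_ldot)
  qed
  then show ?thesis unfolding grad_def using ex by (metis theI)
qed

lemma sym_pos_def_inverse:
  assumes "sym_pos_def H"
  shows "H *v (matrix_inv H *v v) = v"
proof -
  have "inj ((*v) H)"
  proof (rule injI)
    fix x y assume "H *v x = H *v y"
    then have "H *v (x - y) = 0" by (simp add: matrix_vector_mult_diff_distrib)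
    then have "x - y = 0" using assms unfolding sym_pos_def_def by (metis inner_zero_left less_irrefl)
    then show "x = y" by simp
  qed
  then have "invertible H" using matrix_left_invertible_injective invertible_left_inverse by blast
  then have "H ** matrix_inv H = mat 1" unfolding invertible_def matrix_inv_def by (rule someI2_ex) simp
  then show ?thesis by (metis matrix_vector_mul_assoc matrix_vector_mul_lid)
qed

lemma sym_pos_def_commute:
  fixes u v :: "real^'p"
  assumes "sym_pos_def H"
  shows "(H *v u) \<bullet> v = u \<bullet> (H *v v)"
  using assms unfolding sym_pos_def_def
  by (metis dot_lmul_matrix inner_commute transpose_matrix_vector)

lemma sym_pos_def_nonneg:
  assumes "sym_pos_def H"
  shows "(H *v u) \<bullet> u \<ge> 0"
  using assms unfolding sym_pos_def_def by (cases "u = 0") (auto simp: less_imp_le)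

text \<open>Expand \<open>\<langle>H (w - u), w - u\<rangle> \<ge> 0\<close> for \<open>w = H\<^sup>-\<^sup>1 v\<close>. This compares the dual norm with linear
functionals directly, without diagonalizing \<open>H\<close>.\<close>
lemma young_inequality_sym_pos_def:
  fixes u v :: "real^'p"
  assumes "sym_pos_def H"
  shows "2 * (v \<bullet> u) \<le> (matrix_inv H *v v) \<bullet> v + (H *v u) \<bullet> u"
proof -
  define w where "w = matrix_inv H *v v"
  have v: "H *v w = v" unfolding w_def by (rule sym_pos_def_inverse[OF assms])
  have "0 \<le> (H *v (w - u)) \<bullet> (w - u)" by (rule sym_pos_def_nonneg[OF assms])
  also have "\<dots> = v \<bullet> w - v \<bullet> u - (H *v u) \<bullet> w + (H *v u) \<bullet> u"
    by (simp add: matrix_vector_mult_diff_distrib v inner_diff_left inner_diff_right)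
  also have "(H *v u) \<bullet> w = v \<bullet> u"
    using sym_pos_def_commute[OF assms, of u w] v by (simp add: inner_commute)
  finally show ?thesis unfolding w_def by (simp add: inner_commute)
qed

text \<open>The dual norm is continuous, and Young's inequality with the unit vector \<open>u = v / \<parallel>v\<parallel>\<close> bounds
\<open>\<parallel>v\<parallel>\<close> on its sublevel sets, which are therefore compact.\<close>
lemma dual_local_norm_attains_min:
  fixes F :: "real^'p \<Rightarrow> real"
  assumes H: "sym_pos_def (hessian F z)" and S: "closed S" "e0 \<in> S"
  shows "\<exists>e\<in>S. \<forall>e'\<in>S. dual_local_norm F z e \<le> dual_local_norm F z e'"
proof -
  define q where "q = (\<lambda>v. (matrix_inv (hessian F z) *v v) \<bullet> v)"
  obtain B where B: "\<And>u. norm (hessian F z *v u) \<le> norm u * B"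
    using bounded_linear.bounded[OF matrix_vector_mul_bounded_linear[of "hessian F z"]] by blast
  define K where "K = {v \<in> S. q v \<le> q e0}"
  have contq: "continuous_on T q" for T unfolding q_def
    by (intro continuous_intros linear_continuous_on matrix_vector_mul_bounded_linear)
  have "norm v \<le> (q e0 + B) / 2" if "v \<in> K" for v
  proof (cases "v = 0")
    case True
    then show ?thesis
      using B[of "axis undefined 1"] that unfolding K_def q_def
      by (simp add: norm_axis_1) (meson norm_ge_zero order_trans add_nonneg_nonneg)
  next
    case False
    define u where "u = (1 / norm v) *\<^sub>R v"
    have nu: "norm u = 1" unfolding u_def using False by simp
    have "v \<bullet> u = norm v" unfolding u_def using False by (simp add: dot_square_norm power2_eq_square)
    moreover have "(hessian F z *v u) \<bullet> u \<le> B"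
      using norm_cauchy_schwarz[of "hessian F z *v u" u] B[of u] nu by simp
    ultimately have "2 * norm v \<le> q v + B"
      using young_inequality_sym_pos_def[OF H, of v u] unfolding q_def by simp
    then show ?thesis using that unfolding K_def by simp
  qed
  then have "bounded K" unfolding bounded_iff by blast
  moreover have "closed K" unfolding K_def
    by (intro continuous_on_closed_Collect_le contq continuous_intros S)
  ultimately have "compact K" by (simp add: compact_eq_bounded_closed)
  moreover have "e0 \<in> K" unfolding K_def using S by simp
  ultimately obtain e where e: "e \<in> K" "\<And>e'. e' \<in> K \<Longrightarrow> q e \<le> q e'"
    using continuous_attains_inf[OF _ _ contq] by (metis empty_iff)
  have "q e \<le> q e'" if "e' \<in> S" for e'
    using e that unfolding K_def by (cases "q e' \<le> q e0") auto
  then show ?thesis using e(1) unfolding K_def dual_local_norm_def q_def by auto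
qed

lemma closed_op_value:
  fixes A :: "real^'p \<Rightarrow> (real^'p) set"
  assumes "maximally_monotone A"
  shows "closed (A z)"
  unfolding closed_sequential_limits
  using maximally_monotone_closed_graph[OF assms, where x = "\<lambda>_. z"] by blast

lemma dist_zero_le:
  fixes F :: "real^'p \<Rightarrow> real"
  assumes "sym_pos_def (hessian F z)" "closed S" "e0 \<in> S"
  shows "dist_zero F z S \<le> ereal (dual_local_norm F z e0)"
proof -
  obtain e where e: "e \<in> S" "\<And>e'. e' \<in> S \<Longrightarrow> dual_local_norm F z e \<le> dual_local_norm F z e'"
    using dual_local_norm_attains_min[OF assms] by blast
  have "dist_zero F z S = ereal (dual_local_norm F z e)"
    unfolding dist_zero_def by (rule Least_equality) (use e in auto)
  then show ?thesis using e assms(3) by simp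
qed

section \<open>Barriers with positive definite Hessian\<close>

locale nondegenerate_barrier =
  fixes Z :: "(real^'p) set" and F :: "real^'p \<Rightarrow> real" and \<nu> :: real
  assumes closed_Z: "closed Z" and convex_Z: "convex Z"
    and smooth: "twice_differentiable_on F (interior Z)"
    and hessian_pos: "\<And>z. z \<in> interior Z \<Longrightarrow> sym_pos_def (hessian F z)"
    and barrier: "self_concordant_barrier \<nu> F Z"
begin

lemma convex_interior_Z: "convex (interior Z)"
  using convex_Z by (rule convex_interior)

lemma GDERIV_F: "z \<in> interior Z \<Longrightarrow> GDERIV F z :> grad F z"
  using smooth GDERIV_grad unfolding twice_differentiable_on_def by blast

lemma isCont_F: "z \<in> interior Z \<Longrightarrow> isCont F z"
  using GDERIV_F unfolding gderiv_def by (blast intro: has_derivative_continuous)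

lemma continuous_on_grad: "continuous_on (interior Z) (grad F)"
  using smooth differentiable_imp_continuous_within unfolding twice_differentiable_on_def
  by (metis continuous_at_imp_continuous_on)

lemma segment_in_interior:
  assumes "z \<in> interior Z" "y \<in> interior Z" "0 \<le> s" "s \<le> 1"
  shows "z + s *\<^sub>R (y - z) \<in> interior Z"
  using convexD_alt[OF convex_interior_Z assms] by (simp add: algebra_simps)

lemma F_along_line:
  assumes "z + s *\<^sub>R d \<in> interior Z"
  shows "((\<lambda>s. F (z + s *\<^sub>R d)) has_real_derivative grad F (z + s *\<^sub>R d) \<bullet> d) (at s)"
proof -
  have "((\<lambda>s. F (z + s *\<^sub>R d)) has_derivative (\<lambda>h. (h *\<^sub>R d) \<bullet> grad F (z + s *\<^sub>R d))) (at s)"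
    by (rule has_derivative_compose[where g = F])
      (use GDERIV_F[OF assms] in \<open>auto simp: gderiv_def intro!: derivative_eq_intros\<close>)
  then show ?thesis
    unfolding has_field_derivative_def by (rule has_derivative_eq_rhs) (auto simp: inner_commute)
qed

lemma grad_along_line:
  assumes "z + s *\<^sub>R d \<in> interior Z"
  shows "((\<lambda>s. grad F (z + s *\<^sub>R d) \<bullet> d) has_real_derivative
    (hessian F (z + s *\<^sub>R d) *v d) \<bullet> d) (at s)"
proof -
  have "grad F differentiable (at (z + s *\<^sub>R d))"
    using smooth assms unfolding twice_differentiable_on_def by blast
  then have "(grad F has_derivative (\<lambda>h. hessian F (z + s *\<^sub>R d) *v h)) (at (z + s *\<^sub>R d))"
    unfolding hessian_def using jacobian_works by blast
  then have "((\<lambda>s. grad F (z + s *\<^sub>R d)) has_derivative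
      (\<lambda>h. hessian F (z + s *\<^sub>R d) *v (h *\<^sub>R d))) (at s)"
    by (rule has_derivative_compose[where g = "grad F", rotated])
      (auto intro!: derivative_eq_intros)
  then have "((\<lambda>s. grad F (z + s *\<^sub>R d) \<bullet> d) has_derivative
      (\<lambda>h. (hessian F (z + s *\<^sub>R d) *v (h *\<^sub>R d)) \<bullet> d)) (at s)"
    by (rule has_derivative_inner_left)
  then show ?thesis
    unfolding has_field_derivative_def
    by (rule has_derivative_eq_rhs) (auto simp: matrix_vector_mult_scaleR)
qed

lemma grad_strictly_monotone:
  assumes "z \<in> interior Z" "y \<in> interior Z" "z \<noteq> y"
  shows "(grad F y - grad F z) \<bullet> (y - z) > 0"
proof -
  define d where "d = y - z"
  have "grad F (z + 0 *\<^sub>R d) \<bullet> d < grad F (z + 1 *\<^sub>R d) \<bullet> d"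
  proof (rule DERIV_pos_imp_increasing[where f = "\<lambda>s. grad F (z + s *\<^sub>R d) \<bullet> d"])
    fix s :: real assume "0 \<le> s" "s \<le> 1"
    then have mem: "z + s *\<^sub>R d \<in> interior Z" unfolding d_def using assms segment_in_interior by blast
    then have "(hessian F (z + s *\<^sub>R d) *v d) \<bullet> d > 0"
      using hessian_pos assms unfolding sym_pos_def_def d_def by simp
    then show "\<exists>l. ((\<lambda>s. grad F (z + s *\<^sub>R d) \<bullet> d) has_real_derivative l) (at s) \<and> l > 0"
      using grad_along_line[OF mem] by blast
  qed simp
  then show ?thesis unfolding d_def by (simp add: inner_diff_left)
qed

lemma gradient_inequality:
  assumes "z \<in> interior Z" "y \<in> interior Z"
  shows "F z + grad F z \<bullet> (y - z) \<le> F y"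
proof (cases "z = y")
  case False
  define d where "d = y - z"
  have "\<exists>s::real. 0 < s \<and> s < 1 \<and> F (z + 1 *\<^sub>R d) - F (z + 0 *\<^sub>R d) = (1 - 0) * (grad F (z + s *\<^sub>R d) \<bullet> d)"
    by (rule MVT2[where f = "\<lambda>s. F (z + s *\<^sub>R d)"])
      (use F_along_line segment_in_interior[OF assms] in \<open>auto simp: d_def\<close>)
  then obtain s where s: "0 < s" "s < 1" "F y - F z = grad F (z + s *\<^sub>R d) \<bullet> d"
    unfolding d_def by auto
  have "z + s *\<^sub>R d \<in> interior Z" unfolding d_def using s assms segment_in_interior by simp
  moreover have "z \<noteq> z + s *\<^sub>R d" using s False unfolding d_def by simp
  ultimately have "(grad F (z + s *\<^sub>R d) - grad F z) \<bullet> (s *\<^sub>R d) > 0"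
    using grad_strictly_monotone[OF assms(1), of "z + s *\<^sub>R d"] by simp
  then have "grad F (z + s *\<^sub>R d) \<bullet> d > grad F z \<bullet> d"
    using s by (simp add: inner_diff_left zero_less_mult_iff)
  then show ?thesis using s unfolding d_def by simp
qed simp

lemma nu_pos: "\<nu> > 0"
  using barrier unfolding self_concordant_barrier_def by blast

lemma barrier_parameter_bound:
  assumes "z \<in> interior Z"
  shows "2 * (grad F z \<bullet> u) - (hessian F z *v u) \<bullet> u \<le> \<nu>"
proof -
  have "ereal (2 * (grad F z \<bullet> u) - (local_norm F z u)\<^sup>2) \<le> ereal \<nu>"
    using barrier assms unfolding self_concordant_barrier_def
    by (meson SUP_le_iff UNIV_I)
  then show ?thesis
    unfolding local_norm_def using sym_pos_def_nonneg[OF hessian_pos[OF assms]] by simp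
qed

text \<open>The supremum defining the barrier parameter, evaluated at \<open>u = H\<^sup>-\<^sup>1 \<nabla>F\<close>, where it is attained,
equals the squared dual norm of the gradient.\<close>
lemma dual_local_norm_grad_le:
  assumes "z \<in> interior Z"
  shows "dual_local_norm F z (c *\<^sub>R grad F z) \<le> \<bar>c\<bar> * sqrt \<nu>"
proof -
  define w where "w = matrix_inv (hessian F z) *v grad F z"
  have "hessian F z *v w = grad F z"
    unfolding w_def by (rule sym_pos_def_inverse[OF hessian_pos[OF assms]])
  then have "w \<bullet> grad F z \<le> \<nu>"
    using barrier_parameter_bound[OF assms, of w] by (simp add: inner_commute)
  moreover have "dual_local_norm F z (c *\<^sub>R grad F z) = sqrt (c\<^sup>2 * (w \<bullet> grad F z))"
    unfolding dual_local_norm_def w_def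
    by (simp add: matrix_vector_mult_scaleR power2_eq_square mult.assoc)
  ultimately show ?thesis
    by (simp add: real_sqrt_mult mult_left_mono)
qed

text \<open>Optimize the barrier-parameter inequality over multiples of \<open>d\<close>; with \<open>g = \<nabla>F \<bullet> d\<close> and
\<open>h = \<langle>H d, d\<rangle>\<close>, the best multiple is \<open>g / h\<close>.\<close>
lemma grad_inner_sq_le:
  assumes "z \<in> interior Z"
  shows "(grad F z \<bullet> d)\<^sup>2 \<le> \<nu> * ((hessian F z *v d) \<bullet> d)"
proof (cases "d = 0")
  case False
  define h where "h = (hessian F z *v d) \<bullet> d"
  define g where "g = grad F z \<bullet> d"
  have h: "h > 0" using hessian_pos[OF assms] False unfolding sym_pos_def_def h_def by blast
  have quad: "2 * (grad F z \<bullet> (c *\<^sub>R d)) - (hessian F z *v (c *\<^sub>R d)) \<bullet> (c *\<^sub>R d) = 2 * (g * c) - c\<^sup>2 * h" for c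
    unfolding matrix_vector_mult_scaleR inner_scaleR_left inner_scaleR_right g_def h_def
    by (simp add: power2_eq_square)
  have "2 * (g * (g / h)) - (g / h)\<^sup>2 * h \<le> \<nu>"
    using barrier_parameter_bound[OF assms, of "(g / h) *\<^sub>R d"] unfolding quad .
  also have "2 * (g * (g / h)) - (g / h)\<^sup>2 * h = g\<^sup>2 / h"
    using h by (simp add: power2_eq_square field_simps)
  finally show ?thesis using h unfolding g_def h_def by (simp add: field_simps)
qed simp

text \<open>Along the segment from \<open>z\<close> to \<open>y\<close>, the slope \<open>\<phi>\<close> of \<open>F\<close> satisfies the Riccati inequality
\<open>\<phi>' \<ge> \<phi>\<^sup>2 / \<nu>\<close>, so \<open>- 1 / \<phi> - s / \<nu>\<close> is nondecreasing as long as \<open>\<phi> > 0\<close>. An initial slope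
above \<open>\<nu>\<close> would blow up before \<open>s = 1\<close>, although \<open>F\<close> is differentiable up to and including \<open>y\<close>. The bound is
uniform in \<open>z\<close> and \<open>y\<close>, which is what controls the central path at infinity.\<close>
lemma grad_inner_le_nu:
  assumes "z \<in> interior Z" "y \<in> interior Z"
  shows "grad F z \<bullet> (y - z) \<le> \<nu>"
proof (rule ccontr)
  assume big: "\<not> ?thesis"
  define d where "d = y - z"
  define \<phi> where "\<phi> = (\<lambda>s. grad F (z + s *\<^sub>R d) \<bullet> d)"
  define h where "h = (\<lambda>s. (hessian F (z + s *\<^sub>R d) *v d) \<bullet> d)"
  have mem: "z + s *\<^sub>R d \<in> interior Z" if "0 \<le> s" "s \<le> 1" for s
    unfolding d_def using that assms segment_in_interior by blast
  have der: "(\<phi> has_real_derivative h s) (at s)" if "0 \<le> s" "s \<le> 1" for s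
    unfolding \<phi>_def h_def by (rule grad_along_line[OF mem[OF that]])
  have h_nonneg: "h s \<ge> 0" if "0 \<le> s" "s \<le> 1" for s
    unfolding h_def by (intro sym_pos_def_nonneg hessian_pos mem that)
  have "\<phi> 0 > \<nu>" using big unfolding \<phi>_def d_def by simp
  have \<phi>_pos: "\<phi> s > 0" if "0 \<le> s" "s \<le> 1" for s
  proof -
    have "\<phi> 0 \<le> \<phi> s"
      by (rule DERIV_nonneg_imp_nondecreasing[where f = \<phi>, OF that(1)]) (use der h_nonneg that in force)
    then show ?thesis using \<open>\<phi> 0 > \<nu>\<close> nu_pos by linarith
  qed
  define \<psi> where "\<psi> = (\<lambda>s. - inverse (\<phi> s) - s / \<nu>)"
  have "\<psi> 0 \<le> \<psi> 1"
  proof (rule DERIV_nonneg_imp_nondecreasing[where f = \<psi>])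
    fix s :: real assume s: "0 \<le> s" "s \<le> 1"
    have "(\<psi> has_real_derivative h s / (\<phi> s)\<^sup>2 - 1 / \<nu>) (at s)"
      unfolding \<psi>_def using der[OF s] \<phi>_pos[OF s] nu_pos
      by (auto intro!: derivative_eq_intros simp: power2_eq_square field_simps)
    moreover have "1 / \<nu> \<le> h s / (\<phi> s)\<^sup>2"
      using grad_inner_sq_le[OF mem[OF s], of d] \<phi>_pos[OF s] nu_pos unfolding h_def[symmetric]
      unfolding \<phi>_def by (simp add: field_simps h_def)
    ultimately show "\<exists>l. (\<psi> has_real_derivative l) (at s) \<and> l \<ge> 0" by force
  qed simp
  then have "1 / \<nu> + inverse (\<phi> 1) \<le> inverse (\<phi> 0)" unfolding \<psi>_def by simp
  moreover have "inverse (\<phi> 1) > 0" using \<phi>_pos[of 1] by simp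
  moreover have "inverse (\<phi> 0) < 1 / \<nu>"
    using \<open>\<phi> 0 > \<nu>\<close> nu_pos by (simp add: field_simps)
  ultimately show False by linarith
qed

text \<open>Sublevel sets are closed in the whole space, and not only relatively to the interior of
\<open>Z\<close>, because \<open>F\<close> tends to infinity at the frontier.\<close>
lemma closed_sublevel: "closed {z \<in> interior Z. F z \<le> M}"
  unfolding closed_sequential_limits
proof (intro allI impI)
  fix x l assume "(\<forall>n. x n \<in> {z \<in> interior Z. F z \<le> M}) \<and> x \<longlonglongrightarrow> l"
  then have x: "\<And>n. x n \<in> interior Z" "\<And>n. F (x n) \<le> M" "x \<longlonglongrightarrow> l" by auto
  have "l \<in> Z" using closed_Z x closed_sequentially interior_subset by (metis subsetD)
  have "l \<in> interior Z"
  proof (rule ccontr)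
    assume "l \<notin> interior Z"
    then have "l \<in> frontier Z" using \<open>l \<in> Z\<close> closed_Z unfolding frontier_def by simp
    then have "filterlim F at_top (at l within interior Z)"
      using barrier unfolding self_concordant_barrier_def by blast
    moreover have "filterlim x (at l within interior Z) sequentially"
      unfolding filterlim_at using x \<open>l \<notin> interior Z\<close> by (auto intro!: always_eventually)
    ultimately have "filterlim (\<lambda>n. F (x n)) at_top sequentially" by (rule filterlim_compose)
    then have "eventually (\<lambda>n. F (x n) > M) sequentially" unfolding filterlim_at_top_dense by blast
    then show False using x(2) by (auto simp: not_less[symmetric])
  qed
  moreover have "(\<lambda>n. F (x n)) \<longlonglongrightarrow> F l"
    using isCont_F[OF calculation] x(3) by (rule isCont_tendsto_compose)
  then have "F l \<le> M" by (rule LIMSEQ_le_const2) (use x(2) in blast)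
  ultimately show "l \<in> {z \<in> interior Z. F z \<le> M}" by blast
qed

text \<open>By the gradient inequality \<open>F\<close> has an affine minorant. The quadratic term dominates it
together with the linear term, which gives boundedness.\<close>
lemma compact_regularized_sublevel:
  fixes b :: "real^'p"
  assumes "t > 0" "e > 0"
  shows "compact {z \<in> interior Z. t * F z + (e/2) * (z \<bullet> z) + b \<bullet> z \<le> M}"
proof (cases "interior Z = {}")
  case False
  then obtain y where y: "y \<in> interior Z" by blast
  define S where "S = {z \<in> interior Z. t * F z + (e/2) * (z \<bullet> z) + b \<bullet> z \<le> M}"
  \<comment> \<open>Half of the quadratic term absorbs any linear term.\<close>
  have quad: "(e/2) * (z \<bullet> z) + c \<bullet> z \<ge> (e/4) * (z \<bullet> z) - (c \<bullet> c) / e" for c z :: "real^'p"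
  proof -
    have "0 \<le> ((e/2) *\<^sub>R z + c) \<bullet> ((e/2) *\<^sub>R z + c) / e" using assms by simp
    also have "\<dots> = (e/4) * (z \<bullet> z) + c \<bullet> z + (c \<bullet> c) / e"
      using assms by (simp add: inner_add_left inner_add_right inner_commute field_simps)
    finally show ?thesis by linarith
  qed
  define c where "c = t *\<^sub>R grad F y + b"
  define N where "N = (4 / e) * (M - t * F y + t * (grad F y \<bullet> y) + (c \<bullet> c) / e)"
  have "z \<bullet> z \<le> N" if "z \<in> S" for z
  proof -
    have z: "z \<in> interior Z" "t * F z + (e/2) * (z \<bullet> z) + b \<bullet> z \<le> M" using that unfolding S_def by auto
    have "t * (F y + grad F y \<bullet> (z - y)) \<le> t * F z"
      using gradient_inequality[OF y z(1)] assms by (intro mult_left_mono) auto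
    then have "t * F y - t * (grad F y \<bullet> y) + c \<bullet> z + (e/2) * (z \<bullet> z) \<le> M"
      using z(2) unfolding c_def by (simp add: inner_diff_right inner_add_left algebra_simps)
    then have "(e/4) * (z \<bullet> z) \<le> M - t * F y + t * (grad F y \<bullet> y) + (c \<bullet> c) / e"
      using quad[of z c] by linarith
    then have "(4 / e) * ((e/4) * (z \<bullet> z)) \<le> N"
      unfolding N_def using assms by (intro mult_left_mono) auto
    then show ?thesis using assms by simp
  qed
  then have "norm z \<le> sqrt N" if "z \<in> S" for z
    using that by (simp add: norm_eq_sqrt_inner)
  then have "bounded S" unfolding bounded_iff by blast
  moreover have "closed S"
  proof -
    define T where "T = {z \<in> interior Z. F z \<le> (M + (b \<bullet> b) / e) / t}"
    have "F z \<le> (M + (b \<bullet> b) / e) / t" if "z \<in> S" for z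
    proof -
      have "(e/4) * (z \<bullet> z) \<ge> 0" using assms by simp
      then have "t * F z \<le> M + (b \<bullet> b) / e" using quad[of z b] that unfolding S_def by auto
      then show ?thesis using assms by (simp add: field_simps)
    qed
    then have "S = {z \<in> T. t * F z + (e/2) * (z \<bullet> z) + b \<bullet> z \<le> M}" unfolding S_def T_def by blast
    moreover have "continuous_on T F"
      unfolding T_def by (intro continuous_at_imp_continuous_on) (use isCont_F in blast)
    moreover have "closed T" unfolding T_def by (rule closed_sublevel)
    ultimately show ?thesis
      by (simp only:) (intro continuous_on_closed_Collect_le continuous_intros)
  qed
  ultimately show ?thesis unfolding S_def[symmetric] by (simp add: compact_eq_bounded_closed)
qed simp

section \<open>The central path\<close>

text \<open>The term \<open>e *\<^sub>R z\<close> is the gradient of \<open>(e/2) * (z \<bullet> z)\<close>; it supplies the compact sublevel sets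
needed for the fixed point argument.\<close>
lemma regularized_central_point_exists:
  fixes A :: "real^'p \<Rightarrow> (real^'p) set"
  assumes mm: "maximally_monotone A" and dom: "interior Z \<inter> op_dom A \<noteq> {}"
    and "t > 0" "e > 0"
  shows "\<exists>z\<in>interior Z. - (t *\<^sub>R grad F z + e *\<^sub>R z) \<in> A z"
proof -
  obtain y0 a0 where y0: "y0 \<in> interior Z" "a0 \<in> A y0" using dom unfolding op_dom_def by blast
  define \<Psi> where "\<Psi> = (\<lambda>z. t * F z + (e/2) * (z \<bullet> z))"
  show ?thesis
  proof (rule exists_zero_of_sum_with_gradient[where \<Psi> = \<Psi>])
    show "GDERIV \<Psi> z :> t *\<^sub>R grad F z + e *\<^sub>R z" if "z \<in> interior Z" for z
      unfolding \<Psi>_def gderiv_def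
      by (rule derivative_eq_intros GDERIV_F[OF that, unfolded gderiv_def] refl)+
        (auto simp: inner_add_right inner_commute algebra_simps)
    show "continuous_on (interior Z) (\<lambda>z. t *\<^sub>R grad F z + e *\<^sub>R z)"
      by (intro continuous_intros continuous_on_grad)
    show "\<Psi> z + (t *\<^sub>R grad F z + e *\<^sub>R z) \<bullet> (y - z) \<le> \<Psi> y"
      if "z \<in> interior Z" "y \<in> interior Z" for z y
    proof -
      have "t * (F z + grad F z \<bullet> (y - z)) \<le> t * F y"
        using gradient_inequality[OF that] \<open>t > 0\<close> by simp
      moreover have "0 \<le> (e/2) * ((y - z) \<bullet> (y - z))" using \<open>e > 0\<close> by simp
      ultimately show ?thesis unfolding \<Psi>_def
        by (simp add: inner_add_left inner_diff_left inner_diff_right inner_commute algebra_simps)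
    qed
    show "compact {z \<in> interior Z. \<Psi> z + a0 \<bullet> z \<le> \<Psi> y0 + a0 \<bullet> y0}"
      unfolding \<Psi>_def by (rule compact_regularized_sublevel) fact+
  qed (use mm y0 convex_interior_Z in auto)
qed

text \<open>Let the regularization parameter \<open>e n\<close> tend to zero. The horizon hypothesis serves to
keep the regularized solutions \<open>z n\<close> bounded: monotonicity of \<open>A\<close> against a pair \<open>(y, a)\<close>
with \<open>y\<close> in the interior, together with \<open>\<nabla>F (z n) \<bullet> (y - z n) \<le> \<nu>\<close>, bounds \<open>a \<bullet> z n\<close> from
above. Once they are bounded, the gradient inequality at \<open>y\<^sub>0\<close> bounds \<open>F (z n)\<close>, so the \<open>z n\<close>
remain in a compact subset of the interior, where \<open>\<nabla>F\<close> is continuous; the graph of \<open>A\<close> being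
closed, any limit point is central.\<close>
lemma central_point_exists:
  fixes A :: "real^'p \<Rightarrow> (real^'p) set"
  assumes mm: "maximally_monotone A" and dom: "interior Z \<inter> op_dom A \<noteq> {}"
    and hor: "\<And>\<omega>. \<omega> \<in> horizon_cone (interior Z \<inter> op_dom A) \<Longrightarrow> \<omega> \<noteq> 0 \<Longrightarrow>
           \<exists>z\<in>interior Z \<inter> op_dom A. \<exists>a\<in>A z. a \<bullet> \<omega> > 0"
    and t: "t > 0"
  shows "\<exists>z. central_point F A Z t z"
proof -
  define e where "e = (\<lambda>n. inverse (real (Suc n)))"
  have e: "e n > 0" "e n \<le> 1" for n unfolding e_def by (auto simp: inverse_le_1_iff)
  have "\<forall>n. \<exists>z. z \<in> interior Z \<and> - (t *\<^sub>R grad F z + e n *\<^sub>R z) \<in> A z"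
    using regularized_central_point_exists[OF mm dom t e(1)] by blast
  then obtain z where z: "\<And>n. z n \<in> interior Z" "\<And>n. - (t *\<^sub>R grad F (z n) + e n *\<^sub>R z n) \<in> A (z n)"
    by metis
  have key: "a \<bullet> z n \<le> t * (grad F (z n) \<bullet> (y - z n)) + a \<bullet> y + y \<bullet> y" if "a \<in> A y" for a y n
  proof -
    have "(- (t *\<^sub>R grad F (z n) + e n *\<^sub>R z n) - a) \<bullet> (z n - y) \<ge> 0"
      by (rule maximally_monotoneD[OF mm z(2) that])
    then have "a \<bullet> z n \<le> t * (grad F (z n) \<bullet> (y - z n)) + a \<bullet> y + e n * (z n \<bullet> (y - z n))"
      by (simp add: inner_diff_left inner_diff_right inner_add_left algebra_simps)
    \<comment> \<open>The regularization term pulls towards the origin, so it contributes a bounded amount.\<close>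
    moreover have "z n \<bullet> (y - z n) \<le> y \<bullet> y"
    proof -
      have "0 \<le> (y - z n) \<bullet> (y - z n)" by simp
      then have "2 * (z n \<bullet> y) \<le> y \<bullet> y + z n \<bullet> z n"
        by (simp add: inner_diff_left inner_diff_right inner_commute)
      then show ?thesis
        unfolding inner_diff_right using inner_ge_zero[of y] inner_ge_zero[of "z n"] by linarith
    qed
    then have "e n * (z n \<bullet> (y - z n)) \<le> 1 * (y \<bullet> y)"
      using e[of n] by (intro order_trans[OF mult_left_mono mult_right_mono]) auto
    ultimately show ?thesis by simp
  qed
  have "bounded (range z)"
  proof (rule bounded_if_no_horizon_direction[OF _ _ hor])
    show "convex (closure (interior Z \<inter> op_dom A))"
      by (rule convex_closure_open_Int_op_dom[OF mm open_interior convex_interior_Z])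
    show "range z \<subseteq> interior Z \<inter> op_dom A" using z unfolding op_dom_def by blast
    show "\<exists>B. \<forall>v\<in>range z. a \<bullet> v \<le> B" if "y \<in> interior Z \<inter> op_dom A" "a \<in> A y" for y a
    proof -
      have "a \<bullet> z n \<le> t * \<nu> + a \<bullet> y + y \<bullet> y" for n
      proof -
        have "t * (grad F (z n) \<bullet> (y - z n)) \<le> t * \<nu>"
          using that(1) t by (intro mult_left_mono grad_inner_le_nu z) auto
        then show ?thesis using key[OF that(2), of n] by linarith
      qed
      then show ?thesis by blast
    qed
  qed auto
  then obtain R where R: "\<And>n. norm (z n) \<le> R" unfolding bounded_iff by blast
  obtain y0 a0 where y0: "y0 \<in> interior Z" "a0 \<in> A y0" using dom unfolding op_dom_def by blast
  define M where "M = F y0 + (a0 \<bullet> y0 + y0 \<bullet> y0 + norm a0 * R) / t"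
  have "F (z n) \<le> M" for n
  proof -
    have "t * (F (z n) + grad F (z n) \<bullet> (y0 - z n)) \<le> t * F y0"
      using gradient_inequality[OF z(1) y0(1)] t by simp
    moreover have "- (a0 \<bullet> z n) \<le> norm a0 * R"
      using norm_cauchy_schwarz[of "- a0" "z n"] mult_left_mono[OF R[of n], of "norm a0"] by simp
    ultimately have "t * F (z n) \<le> t * F y0 + (a0 \<bullet> y0 + y0 \<bullet> y0 + norm a0 * R)"
      using key[OF y0(2), of n] by (simp add: algebra_simps)
    then show ?thesis unfolding M_def using t by (simp add: field_simps)
  qed
  then have mem: "z n \<in> {z \<in> interior Z. F z \<le> M} \<inter> cball 0 R" for n using z(1) R by simp
  have "compact ({z \<in> interior Z. F z \<le> M} \<inter> cball 0 R)"
    using closed_sublevel by (intro closed_Int_compact) auto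
  then obtain l r where l: "l \<in> interior Z" and r: "strict_mono r" and lim: "(z \<circ> r) \<longlonglongrightarrow> l"
    using mem unfolding compact_def by (metis (no_types, lifting) IntD1 mem_Collect_eq)
  have "isCont (grad F) l"
    using continuous_on_grad l by (simp add: continuous_on_eq_continuous_at)
  then have g: "(\<lambda>n. grad F ((z \<circ> r) n)) \<longlonglongrightarrow> grad F l" using lim by (rule isCont_tendsto_compose)
  have "(\<lambda>n. (e \<circ> r) n) \<longlonglongrightarrow> 0"
    using LIMSEQ_subseq_LIMSEQ[OF LIMSEQ_inverse_real_of_nat r] unfolding e_def by (simp add: comp_def)
  then have "(\<lambda>n. - (t *\<^sub>R grad F ((z \<circ> r) n) + (e \<circ> r) n *\<^sub>R (z \<circ> r) n)) \<longlonglongrightarrow> - (t *\<^sub>R grad F l + 0 *\<^sub>R l)"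
    by (intro tendsto_intros g lim)
  then have "- (t *\<^sub>R grad F l + 0 *\<^sub>R l) \<in> A l"
    by (rule maximally_monotone_closed_graph[OF mm _ _ lim, rotated]) (use z(2) in simp)
  then have "t *\<^sub>R grad F l + - (t *\<^sub>R grad F l) \<in> {t *\<^sub>R grad F l} + A l"
    by (intro set_plus_intro) auto
  then show ?thesis unfolding central_point_def using l by auto
qed

lemma central_point_iff:
  "central_point F A Z t z \<longleftrightarrow> z \<in> interior Z \<and> - (t *\<^sub>R grad F z) \<in> A z"
proof -
  have "0 \<in> {t *\<^sub>R grad F z} + A z \<longleftrightarrow> - (t *\<^sub>R grad F z) \<in> A z"
    by (auto simp: set_plus_def eq_commute[of "0 :: real^'p"] add_eq_0_iff)
  then show ?thesis unfolding central_point_def by simp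
qed

lemma central_point_unique:
  fixes A :: "real^'p \<Rightarrow> (real^'p) set"
  assumes mm: "maximally_monotone A" and "t > 0"
    and "central_point F A Z t z" "central_point F A Z t y"
  shows "z = y"
proof (rule ccontr)
  assume "z \<noteq> y"
  have zy: "z \<in> interior Z" "y \<in> interior Z" "- (t *\<^sub>R grad F z) \<in> A z" "- (t *\<^sub>R grad F y) \<in> A y"
    using assms central_point_iff by blast+
  have "0 \<le> (- (t *\<^sub>R grad F y) - (- (t *\<^sub>R grad F z))) \<bullet> (y - z)"
    by (rule maximally_monotoneD[OF mm zy(4,3)])
  also have "\<dots> = - (t * ((grad F y - grad F z) \<bullet> (y - z)))"
    by (simp add: inner_diff_left algebra_simps)
  also have "\<dots> < 0" using grad_strictly_monotone[OF zy(1,2) \<open>z \<noteq> y\<close>] \<open>t > 0\<close> by simp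
  finally show False by simp
qed

lemma central_point_dist_zero_le:
  fixes A :: "real^'p \<Rightarrow> (real^'p) set"
  assumes mm: "maximally_monotone A" and "t > 0" and c: "central_point F A Z t z"
  shows "dist_zero F z (A z) \<le> ereal (t * sqrt \<nu>)"
proof -
  have z: "z \<in> interior Z" "- (t *\<^sub>R grad F z) \<in> A z" using c central_point_iff by blast+
  have "dist_zero F z (A z) \<le> ereal (dual_local_norm F z (- (t *\<^sub>R grad F z)))"
    by (rule dist_zero_le[OF hessian_pos[OF z(1)] closed_op_value[OF mm] z(2)])
  also have "dual_local_norm F z (- (t *\<^sub>R grad F z)) \<le> t * sqrt \<nu>"
    using dual_local_norm_grad_le[OF z(1), of "- t"] \<open>t > 0\<close> by simp
  finally show ?thesis by simp
qed

end

theorem lemma1: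
  fixes Z :: "(real^'p) set"
    and F :: "real^'p \<Rightarrow> real"
    and A :: "real^'p \<Rightarrow> (real^'p) set"
    and \<nu> :: real
  assumes "Z \<noteq> {}" and "closed Z" and "convex Z"
    and "twice_differentiable_on F (interior Z)"
    and "\<forall>z\<in>interior Z. sym_pos_def (hessian F z)"
    and "self_concordant_barrier \<nu> F Z"
    and "maximally_monotone A"
    and "interior Z \<inter> op_dom A \<noteq> {}"
    and "open (op_dom A) \<or> closed (op_dom A)"
    and "solution_set A Z \<noteq> {}"
    and "\<forall>\<omega>\<in>horizon_cone (interior Z \<inter> op_dom A). \<omega> \<noteq> 0 \<longrightarrow>
           (\<exists>z\<in>interior Z \<inter> op_dom A. \<exists>a\<in>A z. a \<bullet> \<omega> > 0)"
  shows "\<forall>t>0. (\<exists>!z. central_point F A Z t z) \<and>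
           (\<forall>z. central_point F A Z t z \<longrightarrow>
              dist_zero F z (A z) \<le> ereal (t * sqrt \<nu>) \<and>
              (\<forall>\<epsilon>\<ge>0. t \<le> \<epsilon> / sqrt \<nu> \<longrightarrow> eps_solution F A Z \<epsilon> z))"
proof (intro allI impI conjI)
  interpret nondegenerate_barrier Z F \<nu>
    using assms(2-6) by unfold_locales auto
  fix t :: real assume t: "t > 0"
  show "\<exists>!z. central_point F A Z t z"
    using central_point_exists[OF assms(7,8) _ t] assms(11) central_point_unique[OF assms(7) t]
    by blast
  fix z assume c: "central_point F A Z t z"
  show d: "dist_zero F z (A z) \<le> ereal (t * sqrt \<nu>)"
    by (rule central_point_dist_zero_le[OF assms(7) t c])
  fix \<epsilon> :: real assume "t \<le> \<epsilon> / sqrt \<nu>"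
  then have "t * sqrt \<nu> \<le> \<epsilon>" using nu_pos by (simp add: field_simps)
  then have "dist_zero F z (A z) \<le> ereal \<epsilon>" using d by (meson ereal_less_eq(3) order_trans)
  then show "eps_solution F A Z \<epsilon> z" using c unfolding eps_solution_def central_point_def by blast
qed

end
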